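(* The inequality $$\int_0^\infty f(t)\sin(xt)\,dt>0$$ holds for all $x>0$ when $f$ is a function on $(0,\infty)$ that is nonnegative, sectionally continuous and strictly decreasing on its support, with $$\int_0^1 f(t)\,t\,dt<\infty\quad\text{and}\quad \lim_{t\to\infty}f(t)=0.$$
   Context: "Sectionally continuous" means piecewise continuous. The integral over $(0,\infty)$ is an improper integral, possibly only conditionally convergent at infinity.
   Formalization: The support of f is additionally assumed to be nonempty and to be an interval starting at 0; otherwise the claim fails, e.g. for f = 0, or for f(t) = 3 − t on [1,2] and zero elsewhere, with x = π. *)

theory Defs
  imports "HOL-Analysis.Analysis"
begin

text \<open>Sectional continuity on the open half-line: finitely many discontinuities in every compact
  subinterval of \<open>(0, \<infinity>)\<close>, all of them jumps (finite one-sided limits). Nothing is required at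
  \<open>0\<close>, where the function may be unbounded.\<close>

definition sectionally_continuous :: "(real \<Rightarrow> real) \<Rightarrow> bool" where
  "sectionally_continuous f \<longleftrightarrow>
     (\<forall>a b. 0 < a \<longrightarrow> finite {t \<in> {a..b}. \<not> isCont f t}) \<and>
     (\<forall>t>0. (\<exists>l. (f \<longlongrightarrow> l) (at_left t)) \<and> (\<exists>r. (f \<longlongrightarrow> r) (at_right t)))"

text \<open>The integral over \<open>(0, \<infinity>)\<close>, improper at both ends and possibly only conditionally
  convergent. The two endpoints tend to their limits independently. Integrability on compact
  subintervals is required separately because \<^const>\<open>integral\<close> is \<open>0\<close> on non-integrable functions.\<close>

definition has_improper_integral :: "(real \<Rightarrow> real) \<Rightarrow> real \<Rightarrow> bool" where
  "has_improper_integral g I \<longleftrightarrow>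
     (\<forall>a b. 0 < a \<longrightarrow> g integrable_on {a..b}) \<and>
     ((\<lambda>(a, b). integral {a..b} g) \<longlongrightarrow> I) (at_right 0 \<times>\<^sub>F at_top)"

text \<open>The support of a function on \<open>(0, \<infinity>)\<close> is \<open>(0, b)\<close>, \<open>(0, b]\<close> or \<open>(0, \<infinity>)\<close>. A nonnegative function
  ``strictly decreasing on its support'' is understood to have such a support: one that vanishes
  near \<open>0\<close> and jumps up later is not decreasing on \<open>(0, \<infinity>)\<close> (and its sine transform can be negative),
  and for the zero function the transform vanishes. For such supports it makes no difference to
  strict monotonicity whether the support is the set where the function is nonzero, as in
  \<^const>\<open>support_on\<close>, or the closure of that set in \<open>(0, \<infinity>)\<close>.\<close>

definition support_starts_at_zero :: "(real \<Rightarrow> real) \<Rightarrow> bool" where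
  "support_starts_at_zero f \<longleftrightarrow>
     support_on {0<..} f \<noteq> {} \<and>
     (\<forall>s t. 0 < s \<longrightarrow> s < t \<longrightarrow> t \<in> support_on {0<..} f \<longrightarrow> s \<in> support_on {0<..} f)"

end

theory Submission
  imports Defs
begin

text \<open>On the period \<open>[2\<pi>n/x, 2\<pi>(n+1)/x]\<close> with midpoint \<open>m\<close>, the sine integrates to \<open>0\<close>, so \<open>f t\<close> may
  be replaced by \<open>f t - f m\<close> in the integrand. For decreasing \<open>f\<close> this factor changes sign at \<open>m\<close>
  together with \<open>sin (x t)\<close>, so every period contributes a nonnegative amount, and the first period
  a positive one. Convergence at infinity follows from the second mean value theorem, which bounds
  the integral over \<open>[a, b]\<close> by \<open>4 f(a) / x\<close>; at \<open>0\<close> the integrand is dominated by \<open>x f(t) t\<close>.\<close>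

section \<open>Improper integrals from a continuous primitive\<close>

text \<open>When the integral is proper at 0, its primitive from 0 is continuous and vanishes there.
  The integral over \<open>{a..b}\<close> is a difference of two values of this primitive, so the
  limits at the two endpoints decouple.\<close>

lemma has_improper_integralI:
  assumes int: "\<And>b. g integrable_on {0..b}"
    and lim: "((\<lambda>b. integral {0..b} g) \<longlongrightarrow> I) at_top"
  shows "has_improper_integral g I"
  unfolding has_improper_integral_def
proof (intro conjI allI impI)
  fix a b :: real
  assume "0 < a"
  then show "g integrable_on {a..b}"
    by (intro integrable_on_subinterval[OF int[of b]]) auto
next
  let ?G = "\<lambda>b. integral {0..b} g"
  have "continuous_on {0..1} ?G"
    by (rule indefinite_integral_continuous_1[OF int])
  then have "(?G \<longlongrightarrow> ?G 0) (at 0 within {0..1})"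
    by (auto simp: continuous_on_def dest: bspec[where x = 0])
  then have "(?G \<longlongrightarrow> 0) (at_right 0)"
    by (simp add: at_within_Icc_at_right)
  then have "((\<lambda>z. ?G (snd z) - ?G (fst z)) \<longlongrightarrow> I - 0) (at_right 0 \<times>\<^sub>F at_top)"
    by (intro tendsto_diff filterlim_compose[OF lim filterlim_snd]
        filterlim_compose[OF _ filterlim_fst])
  moreover have "\<forall>\<^sub>F z in at_right 0 \<times>\<^sub>F at_top.
      ?G (snd z) - ?G (fst z) = (case z of (a, b) \<Rightarrow> integral {a..b} g)"
    unfolding eventually_prod_filter
  \<comment> \<open>The threshold 1 separates the endpoints: it forces \<open>a < b\<close>, so that
    the integrals over \<open>{0..a}\<close> and \<open>{a..b}\<close> combine.\<close>
  proof (intro exI conjI allI impI)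
    show "\<forall>\<^sub>F a in at_right (0::real). a \<in> {0<..<1}"
      by (rule eventually_at_right_real) simp
    show "\<forall>\<^sub>F b in at_top. (1::real) \<le> b"
      by (rule eventually_ge_at_top)
    fix a b :: real
    assume "a \<in> {0<..<1}" "1 \<le> b"
    then have "?G a + integral {a..b} g = ?G b"
      by (intro Henstock_Kurzweil_Integration.integral_combine int) auto
    then show "?G (snd (a, b)) - ?G (fst (a, b)) = (case (a, b) of (a, b) \<Rightarrow> integral {a..b} g)"
      by simp
  qed
  ultimately show "((\<lambda>(a, b). integral {a..b} g) \<longlongrightarrow> I) (at_right 0 \<times>\<^sub>F at_top)"
    by (auto elim!: Lim_transform_eventually)
qed

section \<open>Integrability and bounds for a decreasing function times a sine\<close>

lemma has_integral_sin_scaled: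
  fixes x a b :: real
  assumes "x \<noteq> 0" "a \<le> b"
  shows "((\<lambda>t. sin (x * t)) has_integral (cos (x * a) - cos (x * b)) / x) {a..b}"
proof -
  have "((\<lambda>t. sin (x * t)) has_integral (- cos (x * b) / x - - cos (x * a) / x)) {a..b}"
    using assms
    by (intro fundamental_theorem_of_calculus)
       (auto simp flip: has_real_derivative_iff_has_vector_derivative
             intro!: derivative_eq_intros)
  then show ?thesis
    by (simp add: diff_divide_distrib)
qed

lemma antimono_mult_sin_integral:
  fixes f :: "real \<Rightarrow> real"
  assumes anti: "antimono_on {a..b} f" and nonneg: "0 \<le> f b" and "a \<le> b" and "0 < x"
  shows "(\<lambda>t. f t * sin (x * t)) integrable_on {a..b}"
    and "\<bar>integral {a..b} (\<lambda>t. f t * sin (x * t))\<bar> \<le> 4 * f a / x"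
proof -
  have sin_int: "(\<lambda>t. sin (x * t)) integrable_on {a..b}"
    using has_integral_sin_scaled[of x a b] assms by blast
  have mono: "- f s \<le> - f t" if "a \<le> s" "s \<le> t" "t \<le> b" for s t
    using monotone_onD[OF anti, of s t] that by auto
  \<comment> \<open>The second mean value theorem is stated for increasing functions, hence the
    detour through \<open>- f\<close>.\<close>
  obtain c where c: "c \<in> {a..b}"
    and hi: "((\<lambda>t. - f t * sin (x * t)) has_integral
        (- f a * integral {a..c} (\<lambda>t. sin (x * t)) + - f b * integral {c..b} (\<lambda>t. sin (x * t)))) {a..b}"
    using second_mean_value_theorem_full[of "\<lambda>t. sin (x * t)" a b "\<lambda>t. - f t"] sin_int \<open>a \<le> b\<close> mono
    by blast
  have hi': "((\<lambda>t. f t * sin (x * t)) has_integral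
        (f a * integral {a..c} (\<lambda>t. sin (x * t)) + f b * integral {c..b} (\<lambda>t. sin (x * t)))) {a..b}"
    using has_integral_neg[OF hi] by (simp add: algebra_simps)
  then show "(\<lambda>t. f t * sin (x * t)) integrable_on {a..b}"
    by blast
  have sin_bound: "\<bar>integral {s..t} (\<lambda>t. sin (x * t))\<bar> \<le> 2 / x" if "s \<le> t" for s t
  proof -
    have "integral {s..t} (\<lambda>t. sin (x * t)) = (cos (x * s) - cos (x * t)) / x"
      using has_integral_sin_scaled[of x s t] that \<open>0 < x\<close> by (simp add: integral_unique)
    moreover have "\<bar>cos (x * s) - cos (x * t)\<bar> \<le> 2"
      using abs_cos_le_one[of "x * s"] abs_cos_le_one[of "x * t"] by linarith
    ultimately show ?thesis
      using \<open>0 < x\<close> by (simp add: abs_divide divide_right_mono)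
  qed
  have fba: "f b \<le> f a"
    using mono[of a b] \<open>a \<le> b\<close> by simp
  have "\<bar>integral {a..b} (\<lambda>t. f t * sin (x * t))\<bar>
      \<le> \<bar>f a * integral {a..c} (\<lambda>t. sin (x * t))\<bar> + \<bar>f b * integral {c..b} (\<lambda>t. sin (x * t))\<bar>"
    unfolding integral_unique[OF hi'] by (rule abs_triangle_ineq)
  \<comment> \<open>Each sine integral is at most \<open>2 / x\<close> in absolute value, and
    \<open>0 \<le> f b \<le> f a\<close> replaces both weights by \<open>f a\<close>.\<close>
  also have "\<dots> \<le> f a * (2 / x) + f a * (2 / x)"
    unfolding abs_mult using c sin_bound fba nonneg by (intro add_mono mult_mono) auto
  also have "\<dots> = 4 * f a / x"
    by simp
  finally show "\<bar>integral {a..b} (\<lambda>t. f t * sin (x * t))\<bar> \<le> 4 * f a / x" .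
qed

text \<open>Near 0, where \<open>f\<close> may be unbounded,
  \<open>\<bar>sin (x * t)\<bar> \<le> x * t\<close> gives the integrable majorant
  \<open>x * (f t * t)\<close>. Beyond 1 the monotonicity of \<open>f\<close> suffices.\<close>

lemma integrable_mult_sin_Icc_0:
  fixes f :: "real \<Rightarrow> real"
  assumes nonneg: "\<And>t. 0 < t \<Longrightarrow> 0 \<le> f t" and anti: "antimono_on {0<..} f"
    and int: "(\<lambda>t. f t * t) integrable_on {0<..1}" and "0 < x"
  shows "(\<lambda>t. f t * sin (x * t)) integrable_on {0..b}"
proof -
  let ?g = "\<lambda>t. f t * sin (x * t)"
  \<comment> \<open>Measurability is inherited from the integrable \<open>f t * t\<close>,
    multiplied by the Borel function \<open>sin (x * t) / t\<close>.\<close>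
  have "(\<lambda>t. (f t * t) * (sin (x * t) / t)) \<in> borel_measurable (lebesgue_on {0<..1})"
    by (intro borel_measurable_times integrable_imp_measurable[OF int]
        measurable_restrict_space1 measurable_completion) measurable
  then have "?g \<in> borel_measurable (lebesgue_on {0<..1})"
    by (rule measurable_cong[THEN iffD1, rotated]) (auto simp: space_restrict_space)
  moreover have "(\<lambda>t. x * (f t * t)) integrable_on {0<..1}"
    using integrable_on_cmult_left[OF int, of x] by simp
  moreover have "\<bar>?g t\<bar> \<le> x * (f t * t)" if "t \<in> {0<..1}" for t
  proof -
    have "\<bar>?g t\<bar> \<le> f t * \<bar>x * t\<bar>"
      unfolding abs_mult[of "f t"] using nonneg[of t] that
      by (intro mult_mono abs_sin_x_le_abs_x) auto
    then show ?thesis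
      using that \<open>0 < x\<close> by (simp add: mult_ac)
  qed
  ultimately have "?g integrable_on {0<..1}"
    by (rule measurable_bounded_by_integrable_imp_integrable_real) auto
  then have "?g integrable_on insert 0 {0<..1}"
    by (simp only: integrable_on_insert_iff)
  also have "insert 0 {0<..1} = {0..(1::real)}"
    by auto
  finally have int1: "?g integrable_on {0..1}" .
  show ?thesis
  proof (cases "b \<le> 1")
    case True
    then show ?thesis
      by (intro integrable_on_subinterval[OF int1]) auto
  next
    case False
    then have "?g integrable_on {1..b}"
      using nonneg \<open>0 < x\<close>
      by (intro antimono_mult_sin_integral(1) monotone_on_subset[OF anti]) auto
    with int1 False show ?thesis
      by (intro Henstock_Kurzweil_Integration.integrable_combine[of 0 1 b]) auto
  qed
qed

section \<open>Sign of the contribution of each period\<close>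

lemma antimono_diff_mult_sin_nonneg:
  fixes f :: "real \<Rightarrow> real" and n :: nat
  assumes anti: "antimono_on {0<..} f" and "0 < x"
    and t: "t \<in> {2 * pi * n / x..2 * pi * Suc n / x}"
  shows "0 \<le> (f t - f ((2 * pi * n + pi) / x)) * sin (x * t)"
\<comment> \<open>The value \<open>f 0\<close> is unconstrained, but the sine vanishes at 0.\<close>
proof (cases "t = 0")
  case False
  \<comment> \<open>The phase within the period: both factors are nonnegative for
    \<open>y \<le> pi\<close> and nonpositive afterwards.\<close>
  define y where "y = x * t - 2 * pi * n"
  let ?m = "(2 * pi * n + pi) / x"
  have "0 \<le> t"
    using t \<open>0 < x\<close> by (auto intro: order_trans[rotated])
  with False have "0 < t"
    by simp
  have "0 < ?m"
    using \<open>0 < x\<close> by (intro divide_pos_pos add_nonneg_pos) auto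
  have y: "0 \<le> y" "y \<le> 2 * pi"
    using t \<open>0 < x\<close> by (auto simp: y_def field_simps)
  have sin: "sin (x * t) = sin y"
    using sin.plus_of_nat[of y n] by (simp add: y_def mult_ac)
  show ?thesis
  proof (cases "y \<le> pi")
    case True
    then have "t \<le> ?m"
      using \<open>0 < x\<close> by (simp add: y_def field_simps)
    then have "f ?m \<le> f t"
      using monotone_onD[OF anti, of t ?m] \<open>0 < t\<close> \<open>0 < ?m\<close> by auto
    moreover have "0 \<le> sin y"
      using True y by (intro sin_ge_zero)
    ultimately show ?thesis
      by (simp add: sin)
  next
    case False
    then have "?m \<le> t"
      using \<open>0 < x\<close> by (simp add: y_def field_simps)
    then have "f t \<le> f ?m"
      using monotone_onD[OF anti, of ?m t] \<open>0 < t\<close> \<open>0 < ?m\<close> by auto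
    moreover have "sin y \<le> 0"
      using False y by (cases "y = 2 * pi") (auto intro: sin_le_zero)
    ultimately show ?thesis
      by (simp add: sin mult_nonpos_nonpos)
  qed
qed simp

lemma has_integral_diff_mult_sin_period:
  fixes f :: "real \<Rightarrow> real" and n :: nat
  assumes "(\<lambda>t. f t * sin (x * t)) integrable_on {2 * pi * n / x..2 * pi * Suc n / x}" and "0 < x"
  shows "((\<lambda>t. (f t - c) * sin (x * t)) has_integral
    integral {2 * pi * n / x..2 * pi * Suc n / x} (\<lambda>t. f t * sin (x * t)))
    {2 * pi * n / x..2 * pi * Suc n / x}"
proof -
  have cos_eq: "cos (2 * pi * real k) = 1" for k
    using cos_2npi[of k] by (simp add: mult_ac)
  have "((\<lambda>t. sin (x * t)) has_integral 0) {2 * pi * n / x..2 * pi * Suc n / x}"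
    using has_integral_sin_scaled[of x "2 * pi * n / x" "2 * pi * Suc n / x"] \<open>0 < x\<close>
    by (simp add: cos_eq divide_right_mono del: of_nat_Suc)
  then have "((\<lambda>t. c * sin (x * t)) has_integral c * 0) {2 * pi * n / x..2 * pi * Suc n / x}"
    by (rule has_integral_mult_right)
  from has_integral_diff[OF integrable_integral[OF assms(1)] this]
  show ?thesis
    by (simp add: left_diff_distrib)
qed

lemma integral_mult_sin_period_nonneg:
  fixes f :: "real \<Rightarrow> real" and n :: nat
  assumes "antimono_on {0<..} f" and "0 < x"
    and "(\<lambda>t. f t * sin (x * t)) integrable_on {2 * pi * n / x..2 * pi * Suc n / x}"
  shows "0 \<le> integral {2 * pi * n / x..2 * pi * Suc n / x} (\<lambda>t. f t * sin (x * t))"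
  using has_integral_diff_mult_sin_period[OF assms(3,2)] antimono_diff_mult_sin_nonneg[OF assms(1,2)]
  by (rule has_integral_nonneg)

text \<open>The integrand with \<open>f (pi / x)\<close> subtracted is nonnegative on the whole
  period and bounded below by a positive constant on \<open>{u / 2..u}\<close>, an interval of
  positive length.\<close>

lemma integral_mult_sin_first_period_pos:
  fixes f :: "real \<Rightarrow> real"
  assumes anti: "antimono_on {0<..} f" and "0 < x"
    and int: "(\<lambda>t. f t * sin (x * t)) integrable_on {0..2 * pi / x}"
    and u: "0 < u" "u \<le> pi / (2 * x)" "f (pi / x) < f u"
  shows "0 < integral {0..2 * pi / x} (\<lambda>t. f t * sin (x * t))"
proof -
  let ?h = "\<lambda>t. (f t - f (pi / x)) * sin (x * t)"
  have hi: "(?h has_integral integral {0..2 * pi / x} (\<lambda>t. f t * sin (x * t))) {0..2 * pi / x}"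
    using has_integral_diff_mult_sin_period[of f x 0] int \<open>0 < x\<close> by simp
  have xu: "x * u \<le> pi / 2"
    using u \<open>0 < x\<close> by (simp add: field_simps)
  have "pi / (2 * x) \<le> 2 * pi / x"
    using \<open>0 < x\<close> by (simp add: field_simps)
  with u have sub: "{u / 2..u} \<subseteq> {0..2 * pi / x}"
    by auto
  have int_sub: "?h integrable_on {u / 2..u}"
    using hi sub by (auto intro: integrable_on_subinterval)
  \<comment> \<open>On \<open>{u / 2..u}\<close> the decreasing \<open>f\<close> is least at
    \<open>u\<close>, while the sine, increasing up to \<open>pi / (2 * x)\<close>, is least at
    \<open>u / 2\<close>.\<close>
  let ?d = "(f u - f (pi / x)) * sin (x * u / 2)"
  have "0 < x * u"
    using u \<open>0 < x\<close> by simp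
  then have "0 < sin (x * u / 2)"
    using xu by (intro sin_gt_zero) linarith+
  then have "0 < ?d * (u / 2)"
    using u by simp
  also have "\<dots> = integral {u / 2..u} (\<lambda>t. ?d)"
    using u by simp
  also have "\<dots> \<le> integral {u / 2..u} ?h"
  proof (rule integral_le[OF _ int_sub])
    fix t assume t: "t \<in> {u / 2..u}"
    have "f u \<le> f t"
      using monotone_onD[OF anti, of t u] t u by auto
    moreover have "sin (x * u / 2) \<le> sin (x * t)"
    proof (rule sin_monotone_2pi_le)
      show "x * u / 2 \<le> x * t"
        using t \<open>0 < x\<close> by (simp add: field_simps)
      have "x * t \<le> x * u"
        using t \<open>0 < x\<close> by simp
      with xu show "x * t \<le> pi / 2"
        by linarith
      show "- (pi / 2) \<le> x * u / 2"
        using \<open>0 < x * u\<close> pi_gt_zero by linarith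
    qed
    ultimately show "?d \<le> ?h t"
      using u \<open>0 < sin (x * u / 2)\<close> by (intro mult_mono) auto
  qed auto
  also have "\<dots> \<le> integral {0..2 * pi / x} ?h"
    using hi antimono_diff_mult_sin_nonneg[OF anti \<open>0 < x\<close>, of _ 0]
    by (intro integral_subset_le[OF sub int_sub]) auto
  also have "\<dots> = integral {0..2 * pi / x} (\<lambda>t. f t * sin (x * t))"
    using hi by (rule integral_unique)
  finally show ?thesis .
qed

section \<open>Convergence and positivity of the sine transform\<close>

text \<open>The integrals up to the period ends \<open>p n\<close> increase and are bounded, hence
  converge. The tail bound and \<open>f \<longlongrightarrow> 0\<close> extend the limit to
  arbitrary upper endpoints, and the limit is at least the positive contribution of the first
  period.\<close>

lemma sine_transform_pos:
  fixes f :: "real \<Rightarrow> real"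
  assumes nonneg: "\<And>t. 0 < t \<Longrightarrow> 0 \<le> f t" and anti: "antimono_on {0<..} f"
    and int: "(\<lambda>t. f t * t) integrable_on {0<..1}" and lim: "(f \<longlongrightarrow> 0) at_top"
    and "0 < x" and u: "0 < u" "u \<le> pi / (2 * x)" "f (pi / x) < f u"
  shows "\<exists>I>0. has_improper_integral (\<lambda>t. f t * sin (x * t)) I"
proof -
  let ?g = "\<lambda>t. f t * sin (x * t)"
  define G where "G = (\<lambda>b. integral {0..b} ?g)"
  define p where "p = (\<lambda>n. 2 * pi * real n / x)"
  have gint: "?g integrable_on {0..b}" for b
    by (rule integrable_mult_sin_Icc_0[OF nonneg anti int \<open>0 < x\<close>])
  have gint': "?g integrable_on {a..b}" if "0 \<le> a" for a b
    using that by (intro integrable_on_subinterval[OF gint[of b]]) auto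
  have G_diff: "G b - G a = integral {a..b} ?g" if "0 \<le> a" "a \<le> b" for a b
    using Henstock_Kurzweil_Integration.integral_combine[OF that gint] by (simp add: G_def)
  have tail: "\<bar>G b - G a\<bar> \<le> 4 * f a / x" if "0 < a" "a \<le> b" for a b
  proof -
    have "antimono_on {a..b} f"
      using that by (intro monotone_on_subset[OF anti]) auto
    from antimono_mult_sin_integral(2)[OF this nonneg \<open>a \<le> b\<close> \<open>0 < x\<close>] show ?thesis
      using that by (simp add: G_diff)
  qed
  have p_top: "filterlim p at_top sequentially"
  proof -
    have "filterlim (\<lambda>n. 2 * pi / x * real n) at_top sequentially"
      using \<open>0 < x\<close>
      by (intro filterlim_tendsto_pos_mult_at_top[OF tendsto_const] filterlim_real_sequentially) simp
    then show ?thesis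
      by (simp add: p_def)
  qed
  have p_mono: "p m \<le> p n" if "m \<le> n" for m n
    using that \<open>0 < x\<close> by (simp add: p_def divide_right_mono)
  have p_nonneg: "0 \<le> p n" for n
    using \<open>0 < x\<close> by (simp add: p_def)
  have p1: "0 < p 1"
    using \<open>0 < x\<close> by (simp add: p_def)
  have inc: "incseq (\<lambda>n. G (p n))"
  proof (rule incseq_SucI)
    fix n
    have "0 \<le> integral {p n..p (Suc n)} ?g"
      unfolding p_def
      by (rule integral_mult_sin_period_nonneg[OF anti \<open>0 < x\<close> gint'])
         (use p_nonneg[of n] in \<open>simp add: p_def\<close>)
    then show "G (p n) \<le> G (p (Suc n))"
      using G_diff[of "p n" "p (Suc n)"] p_nonneg[of n] p_mono[of n "Suc n"] by simp
  qed
  \<comment> \<open>The tail bound starts at \<open>p 1\<close>, because it requires a positive left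
    endpoint and \<open>p 0 = 0\<close>.\<close>
  have "G (p n) \<le> G (p 1) + 4 * f (p 1) / x" for n
  proof (cases "n = 0")
    case True
    have "G (p 0) \<le> G (p 1)"
      using inc by (rule incseqD) simp
    moreover have "0 \<le> 4 * f (p 1) / x"
      using nonneg[OF p1] \<open>0 < x\<close> by simp
    ultimately show ?thesis
      using True by simp
  next
    case False
    then show ?thesis
      using tail[OF p1 p_mono[of 1 n]] by (simp add: abs_le_iff)
  qed
  then obtain I where I: "(\<lambda>n. G (p n)) \<longlonglongrightarrow> I" and le_I: "\<And>n. G (p n) \<le> I"
    using incseq_convergent[OF inc] by blast
  \<comment> \<open>Let the right endpoint in the tail bound run to infinity through the period
    ends.\<close>
  have I_diff: "\<bar>I - G b\<bar> \<le> 4 * f b / x" if "0 < b" for b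
  proof (rule tendsto_upperbound)
    show "(\<lambda>n. \<bar>G (p n) - G b\<bar>) \<longlonglongrightarrow> \<bar>I - G b\<bar>"
      by (intro tendsto_intros I)
    have "\<forall>\<^sub>F n in sequentially. b \<le> p n"
      using p_top by (simp add: filterlim_at_top)
    then show "\<forall>\<^sub>F n in sequentially. \<bar>G (p n) - G b\<bar> \<le> 4 * f b / x"
      by eventually_elim (rule tail[OF that])
  qed simp
  have "((\<lambda>b. I - G b) \<longlongrightarrow> 0) at_top"
  proof (rule Lim_null_comparison)
    show "\<forall>\<^sub>F b in at_top. norm (I - G b) \<le> 4 * f b / x"
      using eventually_gt_at_top[of 0] by eventually_elim (simp add: I_diff)
    show "((\<lambda>b. 4 * f b / x) \<longlongrightarrow> 0) at_top"
      using \<open>0 < x\<close> by (auto intro!: tendsto_eq_intros lim)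
  qed
  from tendsto_diff[OF tendsto_const[of I] this] have "(G \<longlongrightarrow> I) at_top"
    by simp
  then have "has_improper_integral ?g I"
    unfolding G_def by (intro has_improper_integralI gint)
  moreover have "0 < G (p 1)"
    using integral_mult_sin_first_period_pos[OF anti \<open>0 < x\<close> gint u] by (simp add: G_def p_def)
  ultimately show ?thesis
    using le_I[of 1] by (intro exI[of _ I]) auto
qed

section \<open>Monotonicity from the support condition\<close>

text \<open>Right of a support point, \<open>f\<close> is either still in its support and strictly
  smaller, or already 0. Since the support reaches down to 0, a point outside it has only zeros of
  \<open>f\<close> to its right, which gives monotonicity on the whole half-line.\<close>

lemma strict_antimono_support:
  fixes f :: "real \<Rightarrow> real"
  assumes "\<And>t. 0 < t \<Longrightarrow> 0 \<le> f t" and "support_starts_at_zero f"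
    and "strict_antimono_on (support_on {0<..} f) f"
  shows "antimono_on {0<..} f"
    and "\<And>s t. s \<in> support_on {0<..} f \<Longrightarrow> s < t \<Longrightarrow> f t < f s"
proof -
  show lt: "f t < f s" if "s \<in> support_on {0<..} f" "s < t" for s t
  proof (cases "t \<in> support_on {0<..} f")
    case True
    then show ?thesis
      using monotone_onD[OF assms(3) that(1) True that(2)] by simp
  next
    case False
    then show ?thesis
      using that assms(1)[of s] by (auto simp: support_on_def)
  qed
  show "antimono_on {0<..} f"
  proof (rule monotone_onI)
    fix s t :: real
    assume st: "s \<in> {0<..}" "t \<in> {0<..}" "s \<le> t"
    show "f t \<le> f s"
    proof (cases "s \<in> support_on {0<..} f")
      case True
      then show ?thesis
        using lt[of s t] st by (cases "s = t") auto
    next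
      case False
      then have "t \<notin> support_on {0<..} f"
        using assms(2) st unfolding support_starts_at_zero_def
        by (cases "s = t") auto
      then show ?thesis
        using st assms(1)[of s] by (simp add: support_on_def)
    qed
  qed
qed

theorem theorem4p1:
  fixes f :: "real \<Rightarrow> real"
  assumes "\<And>t. 0 < t \<Longrightarrow> 0 \<le> f t"
    and "sectionally_continuous f"
    and "support_starts_at_zero f"
    and "strict_antimono_on (support_on {0<..} f) f"
    and "(\<lambda>t. f t * t) integrable_on {0<..1}"
    and "(f \<longlongrightarrow> 0) at_top"
  shows "\<forall>x>0. \<exists>I>0. has_improper_integral (\<lambda>t. f t * sin (x * t)) I"
proof (intro allI impI)
  fix x :: real
  assume "0 < x"
  obtain s where s: "s \<in> support_on {0<..} f"
    using assms(3) by (auto simp: support_starts_at_zero_def)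
  \<comment> \<open>Lying left of \<open>s\<close> or equal to it keeps \<open>u\<close> in the
    support; the other bound puts it in the first quarter period, before the midpoint
    \<open>pi / x\<close>.\<close>
  define u where "u = min s (pi / (2 * x))"
  have u_pos: "0 < u"
    using s \<open>0 < x\<close> by (auto simp: u_def support_on_def)
  have u_le: "u \<le> pi / (2 * x)"
    by (simp add: u_def)
  have "u \<in> support_on {0<..} f"
    using assms(3) s u_pos unfolding support_starts_at_zero_def
    by (cases "u = s") (auto simp: u_def min_def)
  moreover have "u < pi / x"
    using \<open>0 < x\<close> by (intro order_le_less_trans[OF u_le]) (simp add: field_simps)
  ultimately have "f (pi / x) < f u"
    using strict_antimono_support(2)[of f u "pi / x"] assms(1,3,4) by blast
  with u_pos u_le show "\<exists>I>0. has_improper_integral (\<lambda>t. f t * sin (x * t)) I"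
    using sine_transform_pos[of f x u] strict_antimono_support(1)[of f] assms \<open>0 < x\<close>
    by blast
qed

end
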